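(* Let $A:\mathbb{F}^d\to\mathbb{F}^d$ be a linear operator with spectrum $\sigma(A)$, and let $W$ be a $K$-dimensional subspace of $\mathbb{F}^d$. Assume that $1\notin\sigma(A)$. Then the set of spatial observational vectors $\{b_1,\dots,b_L\}\subset\mathbb{F}^d\setminus\{\mathbf{0}\}$ is complete for the source recovery problem (for $A$ and $W$) if and only if $$\mathrm{rank}\left(P_W(A-I)^{-1}B\right)=K,$$ where $P_W$ denotes the orthogonal projection onto $W$, and $B$ is the matrix having $b_1,\dots,b_L$ as column vectors.
   Context: $\mathbb{F}$ is $\mathbb{R}$ or $\mathbb{C}$, and $\langle x,y\rangle=y^*x$ is the canonical inner product on $\mathbb{F}^d$. Source recovery problem: given $A$ with adjoint $A^*$, a subspace $W\subseteq\mathbb{F}^d$ and vectors $b_1,\dots,b_L\in\mathbb{F}^d$ (called spatial observational vectors), consider the dynamics $x(n+1)=A^*x(n)+\omega$, $n\in\mathbb{N}_0$, $x(0)=x_0$, where the constant source $\omega\in W$ and the initial state $x_0\in\mathbb{F}^d$ are unknown, with measurements $y_\ell(n)=\langle x(n),b_\ell\rangle$, $1\le\ell\le L$. The set $\{b_1,\dots,b_L\}$ is complete if every $\omega\in W$ can be recovered, regardless of $x_0$, by finitely many linear operations from finitely many measurements; that is, there exist $T\in\mathbb{N}_0$ and vectors $u_{n,\ell}\in\mathbb{F}^d$ ($0\le n\le T$, $1\le\ell\le L$) such that $\omega=\sum_{n,\ell}y_\ell(n)\,u_{n,\ell}$ for all $x_0\in\mathbb{F}^d$ and all $\omega\in W$.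 *)

theory Defs
  imports "HOL-Analysis.Analysis" "Jordan_Normal_Form.Conjugate"
begin

(* The scalar field F is real or complex; both are instances of conjugatable_field, where
   conjugate is the identity on real and cnj on complex.  Linear operators on F^d are
   identified with their d x d matrices over F. *)

definition canonical_inner :: "'a::conjugatable_field ^ 'd \<Rightarrow> 'a ^ 'd \<Rightarrow> 'a" where
  "canonical_inner x y = (\<Sum>i\<in>UNIV. conjugate (y $ i) * x $ i)"

definition conj_transpose :: "'a::conjugatable_field ^ 'd ^ 'e \<Rightarrow> 'a ^ 'e ^ 'd" where
  "conj_transpose A = (\<chi> i j. conjugate (A $ j $ i))"

lemma canonical_inner_conj_transpose:
  "canonical_inner (A *v x) y = canonical_inner x (conj_transpose A *v y)"
  for A :: "'a::conjugatable_field ^ 'd ^ 'e"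
  unfolding canonical_inner_def conj_transpose_def matrix_vector_mult_def
  by (simp add: sum_distrib_left sum_distrib_right sum_conjugate conjugate_dist_mul mult_ac,
      rule sum.swap)

(* The spectrum is taken inside the scalar field.  For a real matrix the real spectrum and the
   complex spectrum agree on real numbers, in particular on the number 1. *)
definition spectrum :: "'a::field ^ 'd ^ 'd \<Rightarrow> 'a set" where
  "spectrum A = {c. \<not> invertible (A - mat c)}"

definition orth_proj :: "('a::conjugatable_field ^ 'd) set \<Rightarrow> 'a ^ 'd \<Rightarrow> 'a ^ 'd" where
  "orth_proj W x = (THE p. p \<in> W \<and> (\<forall>w\<in>W. canonical_inner (x - p) w = 0))"

primrec source_state ::
  "'a::conjugatable_field ^ 'd ^ 'd \<Rightarrow> 'a ^ 'd \<Rightarrow> 'a ^ 'd \<Rightarrow> nat \<Rightarrow> 'a ^ 'd" where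
  "source_state A \<omega> x0 0 = x0"
| "source_state A \<omega> x0 (Suc n) = conj_transpose A *v source_state A \<omega> x0 n + \<omega>"

(* The coefficient vectors u must not depend on the unknowns x0 and \<omega>. *)
definition complete_for_source_recovery ::
  "'a::conjugatable_field ^ 'd ^ 'd \<Rightarrow> ('a ^ 'd) set \<Rightarrow> ('l::finite \<Rightarrow> 'a ^ 'd) \<Rightarrow> bool" where
  "complete_for_source_recovery A W b \<longleftrightarrow>
     (\<exists>(T::nat) (u :: nat \<Rightarrow> 'l \<Rightarrow> 'a ^ 'd). \<forall>x0. \<forall>\<omega>\<in>W.
        \<omega> = (\<Sum>n\<le>T. \<Sum>l\<in>UNIV. canonical_inner (source_state A \<omega> x0 n) (b l) *s u n l))"

definition matrix_of_columns :: "('l \<Rightarrow> 'a ^ 'd) \<Rightarrow> 'a ^ 'l ^ 'd" where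
  "matrix_of_columns b = (\<chi> i l. b l $ i)"

end

(* Since 1 is not an eigenvalue, the dynamics has a steady state s = -(A^* - I)^{-1} \<omega>, and
   y_l(n) = <x0 - s, A^n b_l> + <s, b_l> with <s, b_l> = -<\<omega>, (A - I)^{-1} b_l>.
   Differences of consecutive measurements give <x0 - s, A^n (A - I) b_l>.  The span of the vectors
   A^n (A - I) b_l is invariant under the injective map A - I, hence mapped onto itself, so it
   contains b_l.  Thus <\<omega>, P_W (A - I)^{-1} b_l> can be recovered, and if these projections span W,
   so can \<omega>.  Conversely, if they do not span W, some nonzero \<omega> in W is orthogonal to all of them,
   and starting from its steady state only produces zero measurements. *)

theory Submission
  imports Defs
begin

section \<open>Rank and dimension over an arbitrary field\<close>

(* The library has the equality of row and column rank only for real matrices. *)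
lemma dim_rows_le_dim_columns_field:
  fixes A :: "'a::field ^ 'n ^ 'm"
  shows "vec.dim (rows A) \<le> vec.dim (columns A)"
proof -
  obtain B where B: "B \<subseteq> columns A" "vec.independent B" "columns A \<subseteq> vec.span B"
      "card B = vec.dim (columns A)"
    using vec.basis_exists by blast
  have fin: "finite B"
    using B(2) by (rule vec.finiteI_independent)
  have "\<exists>c. column j A = (\<Sum>v\<in>B. c v *s v)" for j
  proof -
    have "column j A \<in> vec.span B"
      using B(3) by (auto simp: columns_def)
    then show ?thesis
      by (auto simp: vec.span_finite[OF fin])
  qed
  then obtain c where c: "\<And>j. column j A = (\<Sum>v\<in>B. c j v *s v)"
    by metis
  \<comment> \<open>A rank factorization read the other way: the coordinates \<open>c j v\<close> of
    the columns in the basis \<open>B\<close> form, for each fixed \<open>v\<close>, a row vector,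
    and these at most \<open>card B\<close> row vectors span all rows of \<open>A\<close>.\<close>
  define R :: "('a ^ 'n) set" where "R = (\<lambda>v. \<chi> j. c j v) ` B"
  have "row i A = (\<Sum>v\<in>B. v $ i *s (\<chi> j. c j v))" for i
  proof -
    have "A $ i $ j = (\<Sum>v\<in>B. c j v * v $ i)" for j
      using arg_cong[OF c[of j], of "\<lambda>x. x $ i"] by (simp add: column_def)
    then show ?thesis
      by (simp add: row_def vec_eq_iff mult.commute)
  qed
  then have "rows A \<subseteq> vec.span R"
    unfolding rows_def R_def by (auto intro!: vec.span_sum vec.span_scale intro: vec.span_base)
  then have "vec.dim (rows A) \<le> card R"
    by (rule vec.dim_le_card) (simp add: R_def fin)
  also have "\<dots> \<le> card B"
    unfolding R_def by (rule card_image_le[OF fin])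
  finally show ?thesis
    by (simp add: B(4))
qed

text \<open>The inequality for \<open>A\<close> and for its transpose gives both directions,
  \<open>rank\<close> being the dimension of the row space.\<close>

lemma rank_eq_dim_columns:
  fixes A :: "'a::field ^ 'n ^ 'm"
  shows "rank A = vec.dim (columns A)"
  using dim_rows_le_dim_columns_field[of A] dim_rows_le_dim_columns_field[of "transpose A"]
  by (simp add: row_rank_def_gen rows_transpose columns_transpose)

text \<open>Injectivity preserves dimension, and a subspace of \<open>Z\<close> of full dimension is
  \<open>Z\<close>.\<close>

lemma inj_linear_image_subspace_eq:
  fixes f :: "'a::field ^ 'd \<Rightarrow> 'a ^ 'd"
  assumes f: "Vector_Spaces.linear (*s) (*s) f" and inj: "inj f"
    and Z: "vec.subspace Z" and sub: "f ` Z \<subseteq> Z"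
  shows "f ` Z = Z"
proof (rule vec.subspace_dim_equal)
  show "vec.subspace (f ` Z)"
    using f Z by (rule vec.linear_subspace_image)
  have "vec.dim (f ` Z) = vec.dim Z"
    using f inj by (intro vec.dim_image_eq) (auto intro: inj_on_subset)
  then show "vec.dim Z \<le> vec.dim (f ` Z)"
    by simp
qed (use Z sub in auto)

section \<open>Algebra of the canonical inner product\<close>

lemma canonical_inner_simps:
  "canonical_inner (x + y) z = canonical_inner x z + canonical_inner y z"
  "canonical_inner (x - y) z = canonical_inner x z - canonical_inner y z"
  "canonical_inner (- x) z = - canonical_inner x z"
  "canonical_inner (c *s x) z = c * canonical_inner x z"
  "canonical_inner 0 z = 0"
  "canonical_inner x (y + z) = canonical_inner x y + canonical_inner x z"
  "canonical_inner x (c *s y) = conjugate c * canonical_inner x y"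
  "canonical_inner x 0 = 0"
  by (simp_all add: canonical_inner_def algebra_simps sum.distrib sum_subtractf sum_negf
      sum_distrib_left conjugate_dist_add conjugate_dist_mul)

lemma canonical_inner_commute: "canonical_inner y x = conjugate (canonical_inner x y)"
  by (simp add: canonical_inner_def sum_conjugate conjugate_dist_mul mult.commute)

lemma canonical_inner_diff_right:
  "canonical_inner x (y - z) = canonical_inner x y - canonical_inner x z"
proof -
  have "canonical_inner x y = canonical_inner x (y - z) + canonical_inner x z"
    by (simp flip: canonical_inner_simps)
  then show ?thesis
    by simp
qed

lemma canonical_inner_axis: "canonical_inner x (axis i c) = conjugate c * x $ i"
proof -
  have "canonical_inner x (axis i c) = (\<Sum>j\<in>UNIV. if j = i then conjugate c * x $ j else 0)"
    unfolding canonical_inner_def by (rule sum.cong) (auto simp: axis_def)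
  then show ?thesis
    by simp
qed

text \<open>By multiplicativity \<open>conjugate 1\<close> is a nonzero idempotent of a
  field.\<close>

lemma conjugate_one [simp]: "conjugate (1 :: 'a::conjugatable_field) = 1"
proof -
  have "conjugate (1 :: 'a) * conjugate 1 = conjugate 1 * 1"
    by (simp flip: conjugate_dist_mul)
  moreover have "conjugate (1 :: 'a) \<noteq> 0"
    by simp
  ultimately show ?thesis
    by (simp only: mult_cancel_left) simp
qed

lemma component_eq_canonical_inner: "x $ i = canonical_inner x (axis i 1)"
  by (simp add: canonical_inner_axis)

lemma conj_transpose_conj_transpose [simp]: "conj_transpose (conj_transpose A) = A"
  by (simp add: conj_transpose_def vec_eq_iff)

lemma canonical_inner_conj_transpose_left:
  "canonical_inner (conj_transpose A *v x) y = canonical_inner x (A *v y)"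
  by (simp add: canonical_inner_conj_transpose)

text \<open>The order on the scalars enters here: a sum of nonnegative terms vanishes only if each
  term does.\<close>

lemma canonical_inner_self_eq_0:
  fixes x :: "'a::conjugatable_ordered_field ^ 'd"
  assumes "canonical_inner x x = 0"
  shows "x = 0"
proof -
  have "(\<Sum>i\<in>UNIV. x $ i * conjugate (x $ i)) = 0"
    using assms by (simp add: canonical_inner_def mult.commute)
  then have "\<forall>i. x $ i * conjugate (x $ i) = 0"
    using conjugate_square_positive by (subst (asm) sum_nonneg_eq_0_iff) auto
  then show ?thesis
    by (simp add: vec_eq_iff)
qed

lemma canonical_inner_span_right:
  assumes "v \<in> vec.span S" and "\<And>s. s \<in> S \<Longrightarrow> canonical_inner x s = 0"
  shows "canonical_inner x v = 0"
  using assms by (induction rule: vec.span_induct_alt) (auto simp: canonical_inner_simps)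

section \<open>Orthogonal projections\<close>

text \<open>A Gram-Schmidt step. The induction hypothesis is used twice, for \<open>x\<close> and
  for the new vector \<open>b\<close>, whose component \<open>e\<close> orthogonal to the old span
  supplies the correction to the projection of \<open>x\<close>.\<close>

lemma exists_orthogonal_projection_span:
  fixes B :: "('a::conjugatable_ordered_field ^ 'd) set"
  assumes "finite B"
  shows "\<exists>p\<in>vec.span B. \<forall>w\<in>vec.span B. canonical_inner (x - p) w = 0"
  using assms
proof (induction B arbitrary: x rule: finite_induct)
  case empty
  then show ?case
    by (simp add: canonical_inner_simps)
next
  case (insert b B)
  obtain q where q: "q \<in> vec.span B" "\<forall>w\<in>vec.span B. canonical_inner (b - q) w = 0"
    using insert.IH by blast
  obtain p where p: "p \<in> vec.span B" "\<forall>w\<in>vec.span B. canonical_inner (x - p) w = 0"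
    using insert.IH by blast
  have mono: "vec.span B \<subseteq> vec.span (insert b B)"
    by (rule vec.span_mono) auto
  define e where "e = b - q"
  \<comment> \<open>This choice makes the new residual orthogonal to \<open>e\<close>. If
    \<open>b\<close> already lies in the old span, then \<open>e = 0\<close> and the value of
    \<open>c\<close> is immaterial.\<close>
  define c where "c = canonical_inner (x - p) e / canonical_inner e e"
  have ortho: "canonical_inner (x - (p + c *s e)) w = 0" if "w \<in> insert b B" for w
  proof (cases "w = b")
    case True
    have pq: "canonical_inner (x - p) q = 0" "canonical_inner e q = 0"
      using p q by (auto simp: e_def)
    have "canonical_inner (x - (p + c *s e)) e = 0"
    proof (cases "canonical_inner e e = 0")
      case True
      then have "e = 0"
        by (rule canonical_inner_self_eq_0)
      then show ?thesis
        by (simp add: canonical_inner_simps)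
    next
      case False
      then show ?thesis
        by (simp add: canonical_inner_simps c_def)
    qed
    moreover have "canonical_inner (x - (p + c *s e)) q = 0"
      using pq by (simp add: canonical_inner_simps)
    moreover have "w = e + q"
      by (simp add: e_def True)
    ultimately show ?thesis
      by (simp only: canonical_inner_simps(6)) simp
  next
    case False
    then have "w \<in> vec.span B"
      using that by (auto intro: vec.span_base)
    then have "canonical_inner (x - p) w = 0" "canonical_inner e w = 0"
      using p q by (auto simp: e_def)
    then show ?thesis
      by (simp add: canonical_inner_simps)
  qed
  have "p + c *s e \<in> vec.span (insert b B)"
    unfolding e_def using p(1) q(1) mono
    by (intro vec.span_add vec.span_scale vec.span_diff) (auto intro: vec.span_base)
  then show ?case
    using canonical_inner_span_right[OF _ ortho] by blast
qed

text \<open>Existence comes from a finite basis of \<open>W\<close>. For uniqueness, the difference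
  of two candidates lies in \<open>W\<close> and is orthogonal to itself. Together they justify the
  definite description in \<open>orth_proj\<close>.\<close>

lemma
  fixes W :: "('a::conjugatable_ordered_field ^ 'd) set"
  assumes W: "vec.subspace W"
  shows orth_proj_in: "orth_proj W x \<in> W"
    and orth_proj_orthogonal: "w \<in> W \<Longrightarrow> canonical_inner (x - orth_proj W x) w = 0"
    and orth_proj_eqI: "p \<in> W \<Longrightarrow> (\<And>w. w \<in> W \<Longrightarrow> canonical_inner (x - p) w = 0) \<Longrightarrow>
      orth_proj W x = p"
proof -
  obtain B where "B \<subseteq> W" "vec.independent B" "W \<subseteq> vec.span B"
    by (rule vec.basis_exists)
  then have B: "finite B" "vec.span B = W"
    using vec.finiteI_independent vec.span_minimal[OF _ W] by blast+
  have ex: "\<exists>p. p \<in> W \<and> (\<forall>w\<in>W. canonical_inner (x - p) w = 0)" for x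
    using exists_orthogonal_projection_span[OF B(1)] B(2) by auto
  have uniq: "p = q" if "p \<in> W \<and> (\<forall>w\<in>W. canonical_inner (x - p) w = 0)"
    "q \<in> W \<and> (\<forall>w\<in>W. canonical_inner (x - q) w = 0)" for p q x
  proof -
    have "p - q \<in> W"
      using that by (auto intro: vec.subspace_diff[OF W])
    then have "canonical_inner (x - q) (p - q) - canonical_inner (x - p) (p - q) = 0"
      using that by simp
    then have "canonical_inner (p - q) (p - q) = 0"
      by (simp flip: canonical_inner_simps)
    then show ?thesis
      using canonical_inner_self_eq_0 by fastforce
  qed
  have proj: "orth_proj W x \<in> W \<and> (\<forall>w\<in>W. canonical_inner (x - orth_proj W x) w = 0)" for x
    unfolding orth_proj_def by (rule theI') (use ex[of x] uniq[where x = x] in blast)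
  show "orth_proj W x \<in> W" and "w \<in> W \<Longrightarrow> canonical_inner (x - orth_proj W x) w = 0"
    using proj by auto
  show "p \<in> W \<Longrightarrow> (\<And>w. w \<in> W \<Longrightarrow> canonical_inner (x - p) w = 0) \<Longrightarrow> orth_proj W x = p"
    using uniq proj by blast
qed

text \<open>Lets the projection be inserted or dropped whenever the other argument is a source in
  \<open>W\<close>.\<close>

lemma canonical_inner_orth_proj:
  fixes W :: "('a::conjugatable_ordered_field ^ 'd) set"
  assumes "vec.subspace W" "w \<in> W"
  shows "canonical_inner w (orth_proj W v) = canonical_inner w v"
proof -
  have "canonical_inner w (v - orth_proj W v) = 0"
    using orth_proj_orthogonal[OF assms] by (simp add: canonical_inner_commute[of w])
  then show ?thesis
    by (simp add: canonical_inner_diff_right)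
qed

lemma linear_orth_proj:
  fixes W :: "('a::conjugatable_ordered_field ^ 'd) set"
  assumes W: "vec.subspace W"
  shows "Vector_Spaces.linear (*s) (*s) (orth_proj W)"
proof (unfold_locales, goal_cases)
  case (1 x y)
  have "x + y - (orth_proj W x + orth_proj W y) = (x - orth_proj W x) + (y - orth_proj W y)"
    by simp
  then show ?case
    by (intro orth_proj_eqI[OF W] vec.subspace_add[OF W] orth_proj_in[OF W])
      (simp only: canonical_inner_simps(1) orth_proj_orthogonal[OF W] add_0)
next
  case (2 c x)
  have "c *s x - c *s orth_proj W x = c *s (x - orth_proj W x)"
    by (simp add: vec.scale_right_diff_distrib)
  then show ?case
    by (intro orth_proj_eqI[OF W] vec.subspace_scale[OF W] orth_proj_in[OF W])
      (simp only: canonical_inner_simps(4) orth_proj_orthogonal[OF W] mult_zero_right)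
qed

lemma matrix_orth_proj_mult:
  fixes W :: "('a::conjugatable_ordered_field ^ 'd) set"
  assumes "vec.subspace W"
  shows "matrix (orth_proj W) *v x = orth_proj W x"
  by (rule matrix_works[OF linear_orth_proj[OF assms]])

section \<open>Matrix inverses and a Krylov span\<close>

lemma invertible_matrix_inv:
  fixes M :: "'a::field ^ 'd ^ 'd"
  assumes "invertible M"
  shows "M ** matrix_inv M = mat 1" and "matrix_inv M ** M = mat 1"
  using assms unfolding invertible_def matrix_inv_def by (metis (mono_tags, lifting) someI_ex)+

text \<open>The span is mapped onto itself by \<open>A - mat 1\<close> and contains the image of
  \<open>v\<close>. That image therefore comes from a vector of the span, which by injectivity is
  \<open>v\<close>.\<close>

lemma in_krylov_span_of_diff:
  fixes A :: "'a::field ^ 'd ^ 'd"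
  assumes "inj ((*v) (A - mat 1))"
  shows "v \<in> vec.span (range (\<lambda>n. ((*v) A ^^ n) ((A - mat 1) *v v)))"
proof -
  let ?D = "(*v) (A - mat 1)"
  define X where "X = range (\<lambda>n. ((*v) A ^^ n) (?D v))"
  have "?D ` X \<subseteq> vec.span X"
  proof
    fix y
    assume "y \<in> ?D ` X"
    then obtain n where "y = ?D (((*v) A ^^ n) (?D v))"
      by (auto simp: X_def)
    \<comment> \<open>Applying \<open>A - mat 1\<close> to a generator gives the difference of two
      successive generators, hence the invariance of the span.\<close>
    then have "y = ((*v) A ^^ Suc n) (?D v) - ((*v) A ^^ n) (?D v)"
      by (simp add: matrix_vector_mult_diff_rdistrib)
    moreover have "((*v) A ^^ m) (?D v) \<in> vec.span X" for m
      unfolding X_def by (intro vec.span_base rangeI)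
    ultimately show "y \<in> vec.span X"
      using vec.span_diff by blast
  qed
  moreover have "?D ` vec.span X = vec.span (?D ` X)"
    by (rule vec.span_image[symmetric])
  ultimately have "?D ` vec.span X \<subseteq> vec.span X"
    using vec.span_minimal by (metis vec.subspace_span)
  then have "?D ` vec.span X = vec.span X"
    using assms by (intro inj_linear_image_subspace_eq) auto
  moreover have "?D v \<in> vec.span X"
    unfolding X_def by (rule vec.span_base, rule range_eqI[where x = 0]) simp
  ultimately have "?D v \<in> ?D ` vec.span X"
    by simp
  then show ?thesis
    using assms by (simp add: inj_image_mem_iff X_def)
qed

section \<open>Scalar quantities recoverable from the measurements\<close>

text \<open>The scalar counterpart of completeness. \<open>g\<close> may depend on \<open>x0\<close>
  as well, because the intermediate quantities, such as deviations from the steady state,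
  do.\<close>

definition recoverable ::
  "'a::conjugatable_field ^ 'd ^ 'd \<Rightarrow> ('a ^ 'd) set \<Rightarrow> ('l::finite \<Rightarrow> 'a ^ 'd) \<Rightarrow>
    ('a ^ 'd \<Rightarrow> 'a ^ 'd \<Rightarrow> 'a) \<Rightarrow> bool" where
  "recoverable A W b g \<longleftrightarrow> (\<exists>(T::nat) q. \<forall>x0. \<forall>\<omega>\<in>W.
     g x0 \<omega> = (\<Sum>n\<le>T. \<Sum>l\<in>UNIV. q n l * canonical_inner (source_state A \<omega> x0 n) (b l)))"

text \<open>Padding with zero coefficients lets several recoverable quantities share one
  horizon.\<close>

lemma recoverable_extend_horizon:
  assumes "recoverable A W b g"
  shows "\<exists>T. \<forall>T'\<ge>T. \<exists>q. \<forall>x0. \<forall>\<omega>\<in>W.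
     g x0 \<omega> = (\<Sum>n\<le>T'. \<Sum>l\<in>UNIV. q n l * canonical_inner (source_state A \<omega> x0 n) (b l))"
proof -
  obtain T q where g: "\<And>x0 \<omega>. \<omega> \<in> W \<Longrightarrow> g x0 \<omega> =
      (\<Sum>n\<le>T. \<Sum>l\<in>UNIV. q n l * canonical_inner (source_state A \<omega> x0 n) (b l))"
    using assms unfolding recoverable_def by blast
  show ?thesis
  proof (intro exI[of _ T] allI impI)
    fix T'
    assume "T' \<ge> T"
    have "(\<Sum>n\<le>T. \<Sum>l\<in>UNIV. q n l * canonical_inner (source_state A \<omega> x0 n) (b l)) =
      (\<Sum>n\<le>T'. \<Sum>l\<in>UNIV. (if n \<le> T then q n l else 0) *
        canonical_inner (source_state A \<omega> x0 n) (b l))" for x0 \<omega>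
      using \<open>T' \<ge> T\<close> by (intro sum.mono_neutral_cong_left) auto
    then show "\<exists>q. \<forall>x0. \<forall>\<omega>\<in>W. g x0 \<omega> =
        (\<Sum>n\<le>T'. \<Sum>l\<in>UNIV. q n l * canonical_inner (source_state A \<omega> x0 n) (b l))"
      using g by (intro exI[of _ "\<lambda>n l. if n \<le> T then q n l else 0"]) simp
  qed
qed

lemma recoverable_cong:
  assumes "\<And>x0 \<omega>. \<omega> \<in> W \<Longrightarrow> g x0 \<omega> = h x0 \<omega>"
  shows "recoverable A W b g \<longleftrightarrow> recoverable A W b h"
  using assms unfolding recoverable_def by simp

lemma recoverable_zero: "recoverable A W b (\<lambda>x0 \<omega>. 0)"
  unfolding recoverable_def by (intro exI[of _ "0::nat"] exI[of _ "\<lambda>n l. 0"]) simp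

lemma recoverable_scale:
  assumes "recoverable A W b g"
  shows "recoverable A W b (\<lambda>x0 \<omega>. c * g x0 \<omega>)"
proof -
  obtain T q where g: "\<And>x0 \<omega>. \<omega> \<in> W \<Longrightarrow> g x0 \<omega> =
      (\<Sum>n\<le>T. \<Sum>l\<in>UNIV. q n l * canonical_inner (source_state A \<omega> x0 n) (b l))"
    using assms unfolding recoverable_def by blast
  show ?thesis
    unfolding recoverable_def
    by (intro exI[of _ T] exI[of _ "\<lambda>n l. c * q n l"])
      (simp add: g sum_distrib_left mult.assoc)
qed

lemma recoverable_add:
  assumes "recoverable A W b g" "recoverable A W b h"
  shows "recoverable A W b (\<lambda>x0 \<omega>. g x0 \<omega> + h x0 \<omega>)"
proof -
  obtain T1 T2 where
    g: "\<forall>T'\<ge>T1. \<exists>q. \<forall>x0. \<forall>\<omega>\<in>W. g x0 \<omega> =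
      (\<Sum>n\<le>T'. \<Sum>l\<in>UNIV. q n l * canonical_inner (source_state A \<omega> x0 n) (b l))" and
    h: "\<forall>T'\<ge>T2. \<exists>q. \<forall>x0. \<forall>\<omega>\<in>W. h x0 \<omega> =
      (\<Sum>n\<le>T'. \<Sum>l\<in>UNIV. q n l * canonical_inner (source_state A \<omega> x0 n) (b l))"
    using assms[THEN recoverable_extend_horizon] by blast
  define T where "T = max T1 T2"
  obtain q r where
    q: "\<forall>x0. \<forall>\<omega>\<in>W. g x0 \<omega> =
      (\<Sum>n\<le>T. \<Sum>l\<in>UNIV. q n l * canonical_inner (source_state A \<omega> x0 n) (b l))" and
    r: "\<forall>x0. \<forall>\<omega>\<in>W. h x0 \<omega> =
      (\<Sum>n\<le>T. \<Sum>l\<in>UNIV. r n l * canonical_inner (source_state A \<omega> x0 n) (b l))"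
    using g[rule_format, of T] h[rule_format, of T] by (auto simp: T_def)
  show ?thesis
    unfolding recoverable_def
    by (intro exI[of _ T] exI[of _ "\<lambda>n l. q n l + r n l"])
      (simp add: q r sum.distrib distrib_right)
qed

lemma recoverable_diff:
  assumes "recoverable A W b g" "recoverable A W b h"
  shows "recoverable A W b (\<lambda>x0 \<omega>. g x0 \<omega> - h x0 \<omega>)"
  using recoverable_add[OF assms(1) recoverable_scale[OF assms(2), of "- 1"]] by simp

lemma recoverable_measurement:
  "recoverable A W b (\<lambda>x0 \<omega>. canonical_inner (source_state A \<omega> x0 n) (b l))"
  unfolding recoverable_def
proof (intro exI[of _ n] exI[of _ "\<lambda>m k. if m = n \<and> k = l then 1 else 0"] allI ballI)
  fix x0 \<omega>
  let ?y = "\<lambda>m k. canonical_inner (source_state A \<omega> x0 m) (b k)"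
  have "(\<Sum>m\<le>n. \<Sum>k\<in>UNIV. (if m = n \<and> k = l then 1 else 0) * ?y m k) =
      (\<Sum>m\<le>n. if m = n then (\<Sum>k\<in>UNIV. if k = l then ?y n k else 0) else 0)"
    by (intro sum.cong refl) (auto simp: mult_delta_left)
  then show "?y n l = (\<Sum>m\<le>n. \<Sum>k\<in>UNIV. (if m = n \<and> k = l then 1 else 0) * ?y m k)"
    by simp
qed

text \<open>Scalars leave the second argument conjugated, but the result is still a linear
  combination of recoverable quantities. It is used both for \<open>h\<close> the deviation from the
  steady state and for \<open>h\<close> the source.\<close>

lemma recoverable_canonical_inner_span:
  assumes "v \<in> vec.span S"
    and "\<And>s. s \<in> S \<Longrightarrow> recoverable A W b (\<lambda>x0 \<omega>. canonical_inner (h x0 \<omega>) s)"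
  shows "recoverable A W b (\<lambda>x0 \<omega>. canonical_inner (h x0 \<omega>) v)"
  using assms
  by (induction rule: vec.span_induct_alt)
    (auto simp: canonical_inner_simps intro!: recoverable_zero recoverable_add recoverable_scale)

section \<open>Steady state and evolution of the measurements\<close>

text \<open>For invertible \<open>A - mat 1\<close> this is the fixed point of the dynamics. Taking
  the adjoint of the inverse lets a pairing with \<open>v\<close> move directly onto
  \<open>matrix_inv (A - mat 1) *v v\<close>.\<close>

definition steady_state :: "'a::conjugatable_field ^ 'd ^ 'd \<Rightarrow> 'a ^ 'd \<Rightarrow> 'a ^ 'd" where
  "steady_state A \<omega> = - (conj_transpose (matrix_inv (A - mat 1)) *v \<omega>)"

lemma canonical_inner_steady_state:
  "canonical_inner (steady_state A \<omega>) v = - canonical_inner \<omega> (matrix_inv (A - mat 1) *v v)"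
  by (simp add: steady_state_def canonical_inner_simps canonical_inner_conj_transpose_left)

text \<open>The deviation from the steady state evolves by the adjoint of \<open>A\<close> alone,
  whose powers move to the second argument as powers of \<open>A\<close>. The induction keeps
  \<open>v\<close> arbitrary since its step passes to \<open>A *v v\<close>.\<close>

lemma canonical_inner_source_state:
  assumes "invertible (A - mat 1)"
  shows "canonical_inner (source_state A \<omega> x0 n) v =
    canonical_inner (x0 - steady_state A \<omega>) (((*v) A ^^ n) v) + canonical_inner (steady_state A \<omega>) v"
proof (induction n arbitrary: v)
  case 0
  show ?case
    by (simp flip: canonical_inner_simps)
next
  case (Suc n)
  let ?s = "steady_state A \<omega>"
  \<comment> \<open>The fixed-point equation of \<open>?s\<close>, tested against
    \<open>v\<close>.\<close>
  have "canonical_inner ?s (A *v v) - canonical_inner ?s v = canonical_inner ?s ((A - mat 1) *v v)"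
    by (simp add: matrix_vector_mult_diff_rdistrib canonical_inner_diff_right)
  also have "\<dots> = - canonical_inner \<omega> v"
    by (simp add: canonical_inner_steady_state matrix_vector_mul_assoc invertible_matrix_inv[OF assms])
  finally have "canonical_inner ?s (A *v v) + canonical_inner \<omega> v = canonical_inner ?s v"
    by (simp add: algebra_simps)
  then show ?case
    by (simp add: canonical_inner_simps(1) canonical_inner_conj_transpose_left Suc.IH
        add.assoc funpow_swap1)
qed

lemma recoverable_source_inner:
  assumes inv: "invertible (A - mat 1)"
  shows "recoverable A W b (\<lambda>x0 \<omega>. canonical_inner \<omega> (matrix_inv (A - mat 1) *v b l))"
proof -
  let ?e = "\<lambda>x0 \<omega>. x0 - steady_state A \<omega>"
  note state = canonical_inner_source_state[OF inv]
  have "recoverable A W b (\<lambda>x0 \<omega>. canonical_inner (?e x0 \<omega>) (((*v) A ^^ n) ((A - mat 1) *v b l)))"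
    for n
  proof -
    \<comment> \<open>Linearity of the powers of \<open>A\<close> splits the vector below into two
      successive iterates of \<open>b l\<close>. In the difference of the two measurements the
      constant steady-state terms cancel.\<close>
    have "((*v) A ^^ n) (x - y) = ((*v) A ^^ n) x - ((*v) A ^^ n) y" for x y :: "'a ^ 'b"
      by (induction n) (simp_all add: vec.diff)
    then have "canonical_inner (?e x0 \<omega>) (((*v) A ^^ n) ((A - mat 1) *v b l)) =
      canonical_inner (source_state A \<omega> x0 (Suc n)) (b l) -
      canonical_inner (source_state A \<omega> x0 n) (b l)" for x0 \<omega>
      unfolding state
      by (simp add: matrix_vector_mult_diff_rdistrib canonical_inner_diff_right funpow_swap1)
    then show ?thesis
      by (simp only:) (intro recoverable_diff recoverable_measurement)
  qed
  then have "recoverable A W b (\<lambda>x0 \<omega>. canonical_inner (?e x0 \<omega>) (b l))"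
    using in_krylov_span_of_diff[OF inj_matrix_vector_mult[OF inv], of "b l"]
    by (rule_tac recoverable_canonical_inner_span) auto
  \<comment> \<open>The measurement at time 0 is the pairing of \<open>x0\<close> with
    \<open>b l\<close>, so subtracting it removes \<open>x0\<close> and leaves minus the pairing of
    the steady state with \<open>b l\<close>.\<close>
  then have "recoverable A W b (\<lambda>x0 \<omega>. canonical_inner (?e x0 \<omega>) (b l) -
      canonical_inner (source_state A \<omega> x0 0) (b l))"
    by (intro recoverable_diff recoverable_measurement)
  then show ?thesis
    unfolding state by (simp add: canonical_inner_steady_state)
qed

section \<open>Criteria for completeness\<close>

text \<open>There are finitely many coordinates, so the maximum of their horizons serves all of
  them, and their coefficients assemble into the vectors \<open>u n l\<close>.\<close>

lemma complete_if_coordinates_recoverable: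
  assumes "\<And>i. recoverable A W b (\<lambda>x0 \<omega>. \<omega> $ i)"
  shows "complete_for_source_recovery A W b"
proof -
  have "\<forall>i. \<exists>T. \<forall>T'\<ge>T. \<exists>q. \<forall>x0. \<forall>\<omega>\<in>W.
     \<omega> $ i = (\<Sum>n\<le>T'. \<Sum>l\<in>UNIV. q n l * canonical_inner (source_state A \<omega> x0 n) (b l))"
    by (intro allI recoverable_extend_horizon assms)
  from choice[OF this] obtain T where T: "\<forall>i. \<forall>T'\<ge>T i. \<exists>q. \<forall>x0. \<forall>\<omega>\<in>W.
     \<omega> $ i = (\<Sum>n\<le>T'. \<Sum>l\<in>UNIV. q n l * canonical_inner (source_state A \<omega> x0 n) (b l))"
    by blast
  define T' where "T' = Max (range T)"
  have "T' \<ge> T i" for i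
    by (simp add: T'_def)
  with T have "\<forall>i. \<exists>q. \<forall>x0. \<forall>\<omega>\<in>W.
     \<omega> $ i = (\<Sum>n\<le>T'. \<Sum>l\<in>UNIV. q n l * canonical_inner (source_state A \<omega> x0 n) (b l))"
    by simp
  from choice[OF this] obtain q where q: "\<And>i x0 \<omega>. \<omega> \<in> W \<Longrightarrow> \<omega> $ i =
      (\<Sum>n\<le>T'. \<Sum>l\<in>UNIV. q i n l * canonical_inner (source_state A \<omega> x0 n) (b l))"
    by blast
  show ?thesis
    unfolding complete_for_source_recovery_def
  proof (intro exI[of _ T'] exI[of _ "\<lambda>n l. \<chi> i. q i n l"] allI ballI)
    fix x0 \<omega>
    assume "\<omega> \<in> W"
    show "\<omega> = (\<Sum>n\<le>T'. \<Sum>l\<in>UNIV.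
        canonical_inner (source_state A \<omega> x0 n) (b l) *s (\<chi> i. q i n l))"
      unfolding vec_eq_iff
      by (subst q[OF \<open>\<omega> \<in> W\<close>, of _ x0]) (simp add: mult.commute)
  qed
qed

lemma complete_iff_projections_span:
  fixes A :: "'a::conjugatable_ordered_field ^ 'd ^ 'd"
  assumes W: "vec.subspace W" and inv: "invertible (A - mat 1)"
  shows "complete_for_source_recovery A W b \<longleftrightarrow>
    W \<subseteq> vec.span (range (\<lambda>l. orth_proj W (matrix_inv (A - mat 1) *v b l)))"
    (is "_ \<longleftrightarrow> W \<subseteq> vec.span (range ?c)")
proof
  assume span: "W \<subseteq> vec.span (range ?c)"
  show "complete_for_source_recovery A W b"
  proof (rule complete_if_coordinates_recoverable)
    fix i
    \<comment> \<open>For a source in \<open>W\<close>, pairing with the projected unit vector gives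
      its coordinate \<open>i\<close>, and this vector lies in the span.\<close>
    have "orth_proj W (axis i 1) \<in> vec.span (range ?c)"
      using span orth_proj_in[OF W] by blast
    moreover have "recoverable A W b (\<lambda>x0 \<omega>. canonical_inner \<omega> s)" if s: "s \<in> range ?c" for s
    proof -
      obtain l where "s = ?c l"
        using s by blast
      then show ?thesis
        using recoverable_source_inner[OF inv, of W b l]
        by (subst recoverable_cong) (auto simp: canonical_inner_orth_proj[OF W])
    qed
    ultimately have "recoverable A W b (\<lambda>x0 \<omega>. canonical_inner \<omega> (orth_proj W (axis i 1)))"
      by (rule recoverable_canonical_inner_span)
    then show "recoverable A W b (\<lambda>x0 \<omega>. \<omega> $ i)"
      by (subst recoverable_cong)
        (auto simp: canonical_inner_orth_proj[OF W] component_eq_canonical_inner[symmetric])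
  qed
next
  assume "complete_for_source_recovery A W b"
  then obtain T u where u: "\<And>x0 \<omega>. \<omega> \<in> W \<Longrightarrow> \<omega> =
      (\<Sum>n\<le>(T::nat). \<Sum>l\<in>UNIV. canonical_inner (source_state A \<omega> x0 n) (b l) *s u n l)"
    unfolding complete_for_source_recovery_def by blast
  let ?V = "vec.span (range ?c)"
  have "?V \<subseteq> W"
    using orth_proj_in[OF W] by (intro vec.span_minimal W) auto
  show "W \<subseteq> ?V"
  proof
    fix \<omega>
    assume "\<omega> \<in> W"
    \<comment> \<open>The part of \<open>\<omega>\<close> invisible to the measurements: it stays in
      \<open>W\<close> because \<open>?V\<close> is contained in \<open>W\<close>.\<close>
    define \<eta> where "\<eta> = \<omega> - orth_proj ?V \<omega>"
    have "\<eta> \<in> W"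
      using \<open>?V \<subseteq> W\<close> \<open>\<omega> \<in> W\<close> orth_proj_in[OF vec.subspace_span]
      unfolding \<eta>_def by (blast intro: vec.subspace_diff[OF W])
    have "canonical_inner \<eta> (?c l) = 0" for l
      unfolding \<eta>_def by (intro orth_proj_orthogonal vec.subspace_span vec.span_base rangeI)
    \<comment> \<open>Started at its steady state the deviation is zero, and the remaining constant
      is minus the pairing of \<open>\<eta>\<close> with \<open>?c l\<close>.\<close>
    then have "canonical_inner (source_state A \<eta> (steady_state A \<eta>) n) (b l) = 0" for n l
      by (simp add: canonical_inner_source_state[OF inv] canonical_inner_simps(5)
          canonical_inner_steady_state canonical_inner_orth_proj[OF W \<open>\<eta> \<in> W\<close>])
    \<comment> \<open>The reconstruction formula returns 0 from zero measurements, so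
      \<open>\<omega>\<close> equals its projection onto \<open>?V\<close>.\<close>
    then have "\<eta> = 0"
      using u[OF \<open>\<eta> \<in> W\<close>, of "steady_state A \<eta>"] by simp
    then show "\<omega> \<in> ?V"
      using orth_proj_in[OF vec.subspace_span, of "range ?c" \<omega>] by (simp add: \<eta>_def)
  qed
qed

lemma columns_matrix_of_columns_mult:
  "columns (M ** matrix_of_columns b) = range (\<lambda>l. M *v b l)"
proof -
  have "column l (M ** matrix_of_columns b) = M *v b l" for l
    by (simp add: column_def matrix_of_columns_def matrix_matrix_mult_def
        matrix_vector_mult_def vec_eq_iff)
  then show ?thesis
    by (auto simp: columns_def)
qed

lemma complete_iff_rank:
  fixes A :: "'a::conjugatable_ordered_field ^ 'd ^ 'd"
  assumes W: "vec.subspace W" and spec: "1 \<notin> spectrum A"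
  shows "complete_for_source_recovery A W b \<longleftrightarrow>
    rank (matrix (orth_proj W) ** matrix_inv (A - mat 1) ** matrix_of_columns b) = vec.dim W"
proof -
  let ?c = "\<lambda>l. orth_proj W (matrix_inv (A - mat 1) *v b l)"
  have inv: "invertible (A - mat 1)"
    using spec by (simp add: spectrum_def)
  have sub: "range ?c \<subseteq> W"
    using orth_proj_in[OF W] by auto
  have "rank (matrix (orth_proj W) ** matrix_inv (A - mat 1) ** matrix_of_columns b) =
      vec.dim (range ?c)"
    by (simp add: rank_eq_dim_columns columns_matrix_of_columns_mult matrix_orth_proj_mult[OF W]
        flip: matrix_vector_mul_assoc)
  \<comment> \<open>The projected vectors lie in \<open>W\<close>, so spanning \<open>W\<close> is a
    matter of dimension.\<close>
  moreover have "W \<subseteq> vec.span (range ?c) \<longleftrightarrow> vec.dim (range ?c) = vec.dim W"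
  proof
    assume "W \<subseteq> vec.span (range ?c)"
    then have "vec.span (range ?c) = W"
      using vec.span_minimal[OF sub W] by blast
    then show "vec.dim (range ?c) = vec.dim W"
      using vec.dim_span[of "range ?c"] by simp
  next
    assume "vec.dim (range ?c) = vec.dim W"
    then have "vec.span (range ?c) = vec.span W"
      using sub by (intro vec.dim_eq_span) auto
    then show "W \<subseteq> vec.span (range ?c)"
      using vec.span_superset by blast
  qed
  ultimately show ?thesis
    using complete_iff_projections_span[OF W inv, where b = b] by simp
qed

theorem theorem2p5:
  shows "(\<forall>(A :: real ^ 'd ^ 'd) (W :: (real ^ 'd) set) (K :: nat) (b :: 'l::finite \<Rightarrow> real ^ 'd).
            vec.subspace W \<longrightarrow> vec.dim W = K \<longrightarrow> 1 \<notin> spectrum A \<longrightarrow> (\<forall>l. b l \<noteq> 0) \<longrightarrow>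
            (complete_for_source_recovery A W b \<longleftrightarrow>
             rank (matrix (orth_proj W) ** matrix_inv (A - mat 1) ** matrix_of_columns b) = K))
       \<and> (\<forall>(A :: complex ^ 'd ^ 'd) (W :: (complex ^ 'd) set) (K :: nat) (b :: 'l::finite \<Rightarrow> complex ^ 'd).
            vec.subspace W \<longrightarrow> vec.dim W = K \<longrightarrow> 1 \<notin> spectrum A \<longrightarrow> (\<forall>l. b l \<noteq> 0) \<longrightarrow>
            (complete_for_source_recovery A W b \<longleftrightarrow>
             rank (matrix (orth_proj W) ** matrix_inv (A - mat 1) ** matrix_of_columns b) = K))"
  \<comment> \<open>\<open>real\<close> and \<open>complex\<close> are both instances of
    \<open>conjugatable_ordered_field\<close>, so the generic criterion covers both.\<close>
  by (intro conjI allI impI) (simp_all add: complete_iff_rank)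

end
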